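(* A finite group $G$ is code-perfect if and only if $G$ has no elements of order $4$.
   Context: All groups are finite; $e$ denotes the identity. For a group $G$ and an inverse-closed subset $S\subseteq G$ with $e\notin S$, the Cayley graph $\mathrm{Cay}(G,S)$ has vertex set $G$, with distinct $x,y$ adjacent iff $yx^{-1}\in S$. A subset $C$ of the vertex set of a graph $\Gamma$ is a perfect code in $\Gamma$ if $C$ is an independent set and every vertex outside $C$ is adjacent to exactly one vertex of $C$. A subset $C$ of a group $G$ is a perfect code of $G$ if there is a Cayley graph $\mathrm{Cay}(G,S)$ in which $C$ is a perfect code. A group $G$ is code-perfect if every proper subgroup of $G$ is a perfect code of $G$ (equivalently, every subgroup is). *)

theory Defs
  imports "HOL-Algebra.Algebra" "Graph_Theory.Graph_Theory"
begin

text \<open>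
  Undirected graphs are the symmetric digraphs of the Graph Theory entry: adjacency of \<open>u\<close> and \<open>v\<close>
  is \<open>dominates \<Gamma> u v\<close>, and in a simple graph each edge is a pair of opposite arcs.
\<close>

definition independent_set :: "('a, 'b) pre_digraph \<Rightarrow> 'a set \<Rightarrow> bool" where
  "independent_set \<Gamma> C \<longleftrightarrow> C \<subseteq> verts \<Gamma> \<and> (\<forall>u\<in>C. \<forall>v\<in>C. \<not> dominates \<Gamma> u v)"

definition perfect_code_in :: "('a, 'b) pre_digraph \<Rightarrow> 'a set \<Rightarrow> bool" where
  "perfect_code_in \<Gamma> C \<longleftrightarrow>
     independent_set \<Gamma> C \<and> (\<forall>v \<in> verts \<Gamma> - C. \<exists>!u. u \<in> C \<and> dominates \<Gamma> v u)"

definition connection_set :: "('a, 'm) monoid_scheme \<Rightarrow> 'a set \<Rightarrow> bool" where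
  "connection_set G S \<longleftrightarrow>
     S \<subseteq> carrier G \<and> (\<forall>s\<in>S. inv\<^bsub>G\<^esub> s \<in> S) \<and> \<one>\<^bsub>G\<^esub> \<notin> S"

definition cayley_graph :: "('a, 'm) monoid_scheme \<Rightarrow> 'a set \<Rightarrow> 'a pair_pre_digraph" where
  "cayley_graph G S =
     \<lparr> pverts = carrier G,
       parcs = {(x, y). x \<in> carrier G \<and> y \<in> carrier G \<and> x \<noteq> y \<and>
                        y \<otimes>\<^bsub>G\<^esub> inv\<^bsub>G\<^esub> x \<in> S} \<rparr>"

definition perfect_code_of_group :: "('a, 'm) monoid_scheme \<Rightarrow> 'a set \<Rightarrow> bool" where
  "perfect_code_of_group G C \<longleftrightarrow>
     (\<exists>S. connection_set G S \<and> perfect_code_in (with_proj (cayley_graph G S)) C)"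

definition code_perfect :: "('a, 'm) monoid_scheme \<Rightarrow> bool" where
  "code_perfect G \<longleftrightarrow>
     (\<forall>H. subgroup H G \<and> H \<noteq> carrier G \<longrightarrow> perfect_code_of_group G H)"

lemma cayley_graph_pair_graph:
  assumes "group G" "finite (carrier G)" "connection_set G S"
  shows "pair_graph (cayley_graph G S)"
proof -
  interpret group G by fact
  have sym: "x \<otimes>\<^bsub>G\<^esub> inv\<^bsub>G\<^esub> y \<in> S"
    if "x \<in> carrier G" "y \<in> carrier G" "y \<otimes>\<^bsub>G\<^esub> inv\<^bsub>G\<^esub> x \<in> S" for x y
  proof -
    have "inv\<^bsub>G\<^esub> (y \<otimes>\<^bsub>G\<^esub> inv\<^bsub>G\<^esub> x) \<in> S"
      using that assms(3) by (auto simp: connection_set_def)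
    then show ?thesis using that by (simp add: inv_mult_group)
  qed
  have "parcs (cayley_graph G S) \<subseteq> carrier G \<times> carrier G"
    by (auto simp: cayley_graph_def)
  then have fin: "finite (parcs (cayley_graph G S))"
    using assms(2) by (meson finite_SigmaI finite_subset)
  show ?thesis
    by unfold_locales
      (use fin assms(2) sym in \<open>auto simp: cayley_graph_def symmetric_def intro!: symI\<close>)
qed

text \<open>The whole group is always a perfect code, so ``every proper subgroup'' in the definition of
  \<open>code_perfect\<close> may be read as ``every subgroup''.\<close>

lemma code_perfect_iff_all_subgroups:
  "code_perfect G \<longleftrightarrow> (\<forall>H. subgroup H G \<longrightarrow> perfect_code_of_group G H)"
proof -
  have "perfect_code_of_group G (carrier G)"
    unfolding perfect_code_of_group_def
    by (rule exI[of _ "{}"])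
      (auto simp: connection_set_def perfect_code_in_def independent_set_def cayley_graph_def)
  then show ?thesis unfolding code_perfect_def by metis
qed

end

theory Submission
  imports Defs
begin

text \<open>
  A subgroup \<open>H\<close> is a perfect code exactly if its right cosets have an inverse-closed transversal
  containing \<open>\<one>\<close>. If \<open>x\<close> has order 4, then \<open>H = {\<one>, x\<^sup>2}\<close> has no such transversal, since
  \<open>H x = {x, x\<^sup>-\<^sup>1}\<close>. Conversely, if no element has order 4, take a maximal inverse-closed partial
  transversal \<open>T\<close> containing \<open>\<one>\<close>. If \<open>T\<close> misses \<open>H a\<close>, counting inside the double coset
  \<open>H a H\<close> gives some \<open>t \<in> H a\<close> such that \<open>T\<close> misses both \<open>H t\<close> and \<open>t H\<close>. Either \<open>t\<close> and
  \<open>t\<^sup>-\<^sup>1\<close> lie in different right cosets and both can be added to \<open>T\<close>, or \<open>t\<^sup>2 \<in> H\<close> and a suitable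
  odd power of \<open>t\<close>, which is an element of \<open>H t\<close> of order at most 2, can be added.
\<close>

section \<open>Inverse-closed transversals and perfect codes\<close>

definition partial_transversal :: "('a, 'm) monoid_scheme \<Rightarrow> 'a set \<Rightarrow> 'a set \<Rightarrow> bool" where
  "partial_transversal G H T \<longleftrightarrow>
     T \<subseteq> carrier G \<and> (\<forall>s\<in>T. inv\<^bsub>G\<^esub> s \<in> T) \<and> \<one>\<^bsub>G\<^esub> \<in> T \<and>
     (\<forall>s\<in>T. \<forall>t\<in>T. s \<otimes>\<^bsub>G\<^esub> inv\<^bsub>G\<^esub> t \<in> H \<longrightarrow> s = t)"

definition full_transversal :: "('a, 'm) monoid_scheme \<Rightarrow> 'a set \<Rightarrow> 'a set \<Rightarrow> bool" where
  "full_transversal G H T \<longleftrightarrow>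
     partial_transversal G H T \<and> (\<forall>a\<in>carrier G. \<exists>t\<in>T. t \<otimes>\<^bsub>G\<^esub> inv\<^bsub>G\<^esub> a \<in> H)"

lemma parcs_cayley_graph:
  "(x, y) \<in> parcs (cayley_graph G S) \<longleftrightarrow>
     x \<in> carrier G \<and> y \<in> carrier G \<and> x \<noteq> y \<and> y \<otimes>\<^bsub>G\<^esub> inv\<^bsub>G\<^esub> x \<in> S"
  by (auto simp: cayley_graph_def)

lemma pverts_cayley_graph: "pverts (cayley_graph G S) = carrier G"
  by (simp add: cayley_graph_def)

context group
begin

lemma inv_mult_cancel_right:
  assumes "x \<in> carrier G" "y \<in> carrier G"
  shows "x \<otimes> inv y \<otimes> y = x" "x \<otimes> y \<otimes> inv y = x"
  using assms by (auto simp: m_assoc)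

text \<open>Since \<open>H\<close> is independent and contains \<open>\<one>\<close>,
  \<open>S\<close> avoids \<open>H\<close>. For \<open>a\<close> outside \<open>H\<close>, unique
  domination of the vertex \<open>inv a\<close> says that \<open>S\<close> has exactly one element
  in \<open>H #> a\<close>. Adding \<open>\<one>\<close> as representative of \<open>H\<close>
  completes the transversal.\<close>

lemma perfect_code_imp_transversal:
  assumes H: "subgroup H G" and "perfect_code_of_group G H"
  shows "\<exists>T. full_transversal G H T"
proof -
  interpret H: subgroup H G by fact
  obtain S where S: "connection_set G S" "perfect_code_in (with_proj (cayley_graph G S)) H"
    using assms(2) unfolding perfect_code_of_group_def by auto
  have SG: "S \<subseteq> carrier G" and Sinv: "\<And>s. s \<in> S \<Longrightarrow> inv s \<in> S" and S1: "\<one> \<notin> S"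
    using S(1) by (auto simp: connection_set_def)
  have disj: "s \<notin> H" if "s \<in> S" for s
  proof
    assume "s \<in> H"
    moreover have "dominates (with_proj (cayley_graph G S)) \<one> s"
      using that S1 SG by (auto simp: parcs_cayley_graph)
    ultimately show False
      using S(2) by (auto simp: perfect_code_in_def independent_set_def)
  qed
  have ex1: "\<exists>!u. u \<in> H \<and> u \<otimes> a \<in> S" if a: "a \<in> carrier G" "a \<notin> H" for a
  proof -
    have na: "inv a \<notin> H"
      using a H.m_inv_closed[of "inv a"] by auto
    then have "\<exists>!u. u \<in> H \<and> dominates (with_proj (cayley_graph G S)) (inv a) u"
      using S(2) a by (simp add: perfect_code_in_def pverts_cayley_graph)
    moreover have "u \<in> H \<and> dominates (with_proj (cayley_graph G S)) (inv a) u \<longleftrightarrow>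
        u \<in> H \<and> u \<otimes> a \<in> S" for u
      using a na by (auto simp: parcs_cayley_graph)
    ultimately show ?thesis by simp
  qed
  have uniq: "s = t" if s: "s \<in> S" and t: "t \<in> S" and st: "s \<otimes> inv t \<in> H" for s t
  proof -
    have "s \<in> carrier G" "t \<in> carrier G" using s t SG by auto
    \<comment> \<open>Both \<open>s \<otimes> inv t\<close> and \<open>\<one>\<close> are elements
      of \<open>H\<close> carrying \<open>t\<close> into \<open>S\<close>, so \<open>ex1\<close> at
      \<open>t\<close> identifies them.\<close>
    then have "s \<otimes> inv t \<otimes> t \<in> S" "\<one> \<otimes> t \<in> S"
      using s t by (auto simp: inv_mult_cancel_right)
    then have "s \<otimes> inv t = \<one>"
      using ex1[of t] disj[OF t] st \<open>t \<in> carrier G\<close> by auto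
    then show ?thesis
      using \<open>s \<in> carrier G\<close> \<open>t \<in> carrier G\<close> by (metis inv_equality inv_inv inv_closed)
  qed
  have "partial_transversal G H (insert \<one> S)"
    unfolding partial_transversal_def
  proof (intro conjI ballI impI)
    fix s t assume st: "s \<in> insert \<one> S" "t \<in> insert \<one> S" "s \<otimes> inv t \<in> H"
    then show "s = t"
      using uniq disj SG Sinv by (auto simp: subset_iff)
  qed (use SG Sinv in auto)
  moreover have "\<exists>t\<in>insert \<one> S. t \<otimes> inv a \<in> H" if a: "a \<in> carrier G" for a
  proof (cases "a \<in> H")
    case True
    then show ?thesis by auto
  next
    case False
    then obtain u where "u \<in> H" "u \<otimes> a \<in> S" using ex1 a by blast
    then show ?thesis
      using a by (intro bexI[of _ "u \<otimes> a"]) (auto simp: inv_mult_cancel_right)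
  qed
  ultimately show ?thesis by (auto simp: full_transversal_def)
qed

text \<open>With connection set \<open>T - {\<one>}\<close>, sending \<open>u\<close> to
  \<open>u \<otimes> inv v\<close> matches the neighbours in \<open>H\<close> of a vertex
  \<open>v\<close> outside \<open>H\<close> with the elements of \<open>T\<close> in
  \<open>H #> inv v\<close>, and there is exactly one of those.\<close>

lemma transversal_imp_perfect_code:
  assumes H: "subgroup H G" and T: "full_transversal G H T"
  shows "perfect_code_of_group G H"
proof -
  interpret H: subgroup H G by fact
  have TG: "T \<subseteq> carrier G" and Tinv: "\<And>s. s \<in> T \<Longrightarrow> inv s \<in> T" and T1: "\<one> \<in> T"
    and uniq: "\<And>s t. s \<in> T \<Longrightarrow> t \<in> T \<Longrightarrow> s \<otimes> inv t \<in> H \<Longrightarrow> s = t"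
    and ex: "\<And>a. a \<in> carrier G \<Longrightarrow> \<exists>t\<in>T. t \<otimes> inv a \<in> H"
    using T by (auto simp: full_transversal_def partial_transversal_def)
  define S where "S = T - {\<one>}"
  have conn: "connection_set G S"
    using TG Tinv by (auto simp: connection_set_def S_def subset_iff)
  \<comment> \<open>The coset \<open>H\<close> is already represented in \<open>T\<close> by
    \<open>\<one>\<close>.\<close>
  have disj: "s \<notin> H" if "s \<in> S" for s
    using uniq[of s \<one>] that T1 TG by (auto simp: S_def)
  have ex1: "\<exists>!u. u \<in> H \<and> dominates (with_proj (cayley_graph G S)) v u"
    if v: "v \<in> carrier G" "v \<notin> H" for v
  proof -
    obtain t where t: "t \<in> T" "t \<otimes> v \<in> H" using ex[of "inv v"] v by auto
    have tG: "t \<in> carrier G" using t TG by auto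
    have "t \<noteq> \<one>" using t v by auto
    show ?thesis
    proof (intro ex1I[of _ "t \<otimes> v"] conjI)
      show "dominates (with_proj (cayley_graph G S)) v (t \<otimes> v)"
        using t v tG \<open>t \<noteq> \<one>\<close>
        by (auto simp: parcs_cayley_graph S_def inv_mult_cancel_right)
    next
      fix u assume u: "u \<in> H \<and> dominates (with_proj (cayley_graph G S)) v u"
      then have uG: "u \<in> carrier G" and uT: "u \<otimes> inv v \<in> T"
        by (auto simp: parcs_cayley_graph S_def)
      have "u \<otimes> inv v \<otimes> inv t = u \<otimes> inv (t \<otimes> v)"
        using uG v tG by (simp add: inv_mult_group m_assoc)
      also have "\<dots> \<in> H" using u t by auto
      finally have "u \<otimes> inv v = t" using uniq uT t by blast
      then show "u = t \<otimes> v" using uG v inv_mult_cancel_right by auto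
    qed (use t in auto)
  qed
  have "perfect_code_in (with_proj (cayley_graph G S)) H"
    unfolding perfect_code_in_def independent_set_def
  proof (intro conjI ballI)
    fix u v assume "u \<in> H" "v \<in> H"
    then show "\<not> dominates (with_proj (cayley_graph G S)) u v"
      using disj[of "v \<otimes> inv u"] by (auto simp: parcs_cayley_graph)
  qed (use ex1 H.subset in \<open>auto simp: pverts_cayley_graph\<close>)
  then show ?thesis using conn unfolding perfect_code_of_group_def by blast
qed

section \<open>Enlarging partial transversals\<close>

text \<open>As \<open>t \<otimes> t\<close> lies in \<open>H\<close>, all odd powers of
  \<open>t\<close> lie in \<open>H #> t\<close>. The exponent chosen is the odd part of
  \<open>ord t\<close>; since 4 cannot divide \<open>ord t\<close>, this power squares to
  \<open>\<one>\<close>.\<close>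

lemma involution_in_coset:
  assumes fin: "finite (carrier G)" and no4: "\<And>x. x \<in> carrier G \<Longrightarrow> ord x \<noteq> 4"
    and H: "subgroup H G" and t: "t \<in> carrier G" "t \<otimes> t \<in> H"
  obtains y where "y \<in> carrier G" "y \<otimes> inv t \<in> H" "inv y = y"
proof -
  interpret H: subgroup H G by fact
  \<comment> \<open>Finiteness rules out the value 0 that \<open>ord\<close> takes on elements of
    infinite order, so the power of 2 can be split off.\<close>
  have "ord t > 0" using ord_ge_1[OF fin t(1)] by simp
  then obtain k m where km: "ord t = 2 ^ k * m" "odd m"
    by (metis multiplicity_decompose'[of "ord t" 2] nat_less_le not_prime_unit two_is_prime_nat)
  then obtain j where j: "m = Suc (2 * j)" by (metis oddE Suc_eq_plus1)
  define y where "y = t [^] m"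
  have yG: "y \<in> carrier G" using t by (simp add: y_def)
  have "y \<otimes> inv t = t [^] (2 * j)"
    using t by (simp add: y_def j inv_mult_cancel_right)
  also have "\<dots> = (t \<otimes> t) [^] j"
    using t nat_pow_pow[of t 2 j] by (simp add: numeral_2_eq_2)
  also have "\<dots> \<in> H" using t(2) by (induction j) auto
  finally have yH: "y \<otimes> inv t \<in> H" .
  have "k < 2"
  proof (rule ccontr)
    assume "\<not> k < 2"
    \<comment> \<open>Here 4 divides \<open>ord t\<close>, and raising \<open>t\<close> to a quarter
      of its order produces the forbidden order 4.\<close>
    then have "ord t = 4 * (2 ^ (k - 2) * m)"
      using km by (simp add: le_iff_add[of 2 k] not_less) (auto simp: power_add)
    moreover have "2 ^ (k - 2) * m \<noteq> 0" using km(2) by (cases m) auto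
    ultimately have "ord (t [^] (2 ^ (k - 2) * m)) = 4"
      using ord_pow_gen[OF t(1), of "2 ^ (k - 2) * m"] by simp
    then show False using no4 t by simp
  qed
  then have "ord t dvd m * 2"
    using km by (cases k) (auto simp: less_Suc_eq)
  then have "t [^] (m * 2) = \<one>" using t pow_eq_id by blast
  then have "y \<otimes> y = \<one>"
    using t nat_pow_pow[of t m 2] by (simp add: y_def numeral_2_eq_2)
  then have "inv y = y" using yG by (simp add: inv_equality)
  then show ?thesis using that yG yH by blast
qed

text \<open>Inversion exchanges the left coset \<open>t <# H\<close> with the right coset
  \<open>H #> inv t\<close>, so the inverse-closed set \<open>T\<close> misses the right cosets of
  both \<open>t\<close> and \<open>inv t\<close>. The new elements can then clash only with each
  other, which \<open>tt\<close> excludes.\<close>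

lemma partial_transversal_insert:
  assumes H: "subgroup H G" and T: "partial_transversal G H T" and t: "t \<in> carrier G"
    and miss_r: "\<And>s. s \<in> T \<Longrightarrow> s \<otimes> inv t \<notin> H" and miss_l: "\<And>s. s \<in> T \<Longrightarrow> inv s \<otimes> t \<notin> H"
    and tt: "inv t = t \<or> t \<otimes> t \<notin> H"
  shows "partial_transversal G H (insert t (insert (inv t) T))"
proof -
  interpret H: subgroup H G by fact
  have TG: "\<And>s. s \<in> T \<Longrightarrow> s \<in> carrier G" and Tinv: "\<And>s. s \<in> T \<Longrightarrow> inv s \<in> T" and T1: "\<one> \<in> T"
    and uniq: "\<And>s t. s \<in> T \<Longrightarrow> t \<in> T \<Longrightarrow> s \<otimes> inv t \<in> H \<Longrightarrow> s = t"
    using T by (auto simp: partial_transversal_def)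
  have flip: "y \<otimes> inv x \<in> H \<longleftrightarrow> x \<otimes> inv y \<in> H" if "x \<in> carrier G" "y \<in> carrier G" for x y
    using that by (metis H.m_inv_closed inv_closed inv_inv inv_mult_group)
  have T_misses: "s \<otimes> inv t \<notin> H" "t \<otimes> inv s \<notin> H" "s \<otimes> t \<notin> H" "inv t \<otimes> inv s \<notin> H"
    if s: "s \<in> T" for s
  proof -
    show "s \<otimes> inv t \<notin> H" using miss_r s .
    then show "t \<otimes> inv s \<notin> H" using flip s t TG by blast
    \<comment> \<open>This is \<open>miss_l\<close> applied to \<open>inv s\<close>, again an
      element of \<open>T\<close>.\<close>
    show "s \<otimes> t \<notin> H" using miss_l[OF Tinv[OF s]] s TG by simp
    then show "inv t \<otimes> inv s \<notin> H" using flip[of s "inv t"] s t TG by simp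
  qed
  have tt': "inv t = t \<or> inv t \<otimes> inv t \<notin> H"
    using tt flip[of t "inv t"] t by auto
  have same: "x = y" if xy: "x \<in> insert t (insert (inv t) T)" "y \<in> insert t (insert (inv t) T)"
      "x \<otimes> inv y \<in> H" for x y
  proof (cases "x \<in> T \<and> y \<in> T")
    case True
    then show ?thesis using uniq xy(3) by blast
  next
    case False
    then consider "x \<in> T" "y = t \<or> y = inv t" | "y \<in> T" "x = t \<or> x = inv t"
      | "x = t \<or> x = inv t" "y = t \<or> y = inv t"
      using xy(1,2) by blast
    then show ?thesis
    proof cases
      case 1
      then show ?thesis using xy(3) T_misses[of x] t by auto
    next
      case 2
      then show ?thesis using xy(3) T_misses[of y] by auto
    next
      case 3
      then show ?thesis using xy(3) tt tt' t by auto
    qed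
  qed
  then show ?thesis
    unfolding partial_transversal_def
  proof (intro conjI ballI impI)
    fix x y
    assume "x \<in> insert t (insert (inv t) T)" "y \<in> insert t (insert (inv t) T)" "x \<otimes> inv y \<in> H"
    then show "x = y" by (rule same)
  next
    show "insert t (insert (inv t) T) \<subseteq> carrier G" using TG t inv_closed by blast
    show "\<one> \<in> insert t (insert (inv t) T)" using T1 by blast
    fix s assume "s \<in> insert t (insert (inv t) T)"
    then show "inv s \<in> insert t (insert (inv t) T)" using Tinv inv_inv[OF t] by fastforce
  qed
qed

text \<open>Count in the double coset \<open>D\<close> of \<open>a\<close>. The right cosets of the
  elements of \<open>S\<close> are disjoint and miss \<open>a\<close>, so they do not fill
  \<open>D\<close>. Equally many left cosets of the same size cannot cover \<open>D\<close> either,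
  and an uncovered point yields \<open>t\<close>.\<close>

lemma missed_coset_representative:
  assumes fin: "finite (carrier G)" and H: "subgroup H G" and T: "partial_transversal G H T"
    and a: "a \<in> carrier G" and miss: "\<And>s. s \<in> T \<Longrightarrow> s \<otimes> inv a \<notin> H"
  obtains t where "t \<in> carrier G" "t \<otimes> inv a \<in> H" "\<And>s. s \<in> T \<Longrightarrow> inv s \<otimes> t \<notin> H"
proof -
  interpret H: subgroup H G by fact
  have TG: "\<And>s. s \<in> T \<Longrightarrow> s \<in> carrier G"
    and uniq: "\<And>s t. s \<in> T \<Longrightarrow> t \<in> T \<Longrightarrow> s \<otimes> inv t \<in> H \<Longrightarrow> s = t"
    using T by (auto simp: partial_transversal_def)
  define D where "D = {h \<otimes> a \<otimes> k | h k. h \<in> H \<and> k \<in> H}"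
  define S where "S = T \<inter> D"
  have DG: "D \<subseteq> carrier G" using a by (auto simp: D_def)
  have finD: "finite D" and finH: "finite H"
    using fin DG H.subset finite_subset by auto
  then have finS: "finite S" by (simp add: S_def)
  have SG: "\<And>s. s \<in> S \<Longrightarrow> s \<in> carrier G" using TG by (auto simp: S_def)
  have card_r: "card (H #> s) = card H" if "s \<in> S" for s
    using SG[OF that] H.subset by (metis card_rcosets_equal rcosetsI)
  have "card (\<Union>s\<in>S. H #> s) = (\<Sum>s\<in>S. card (H #> s))"
  proof (rule card_UN_disjoint[OF finS])
    show "\<forall>s\<in>S. finite (H #> s)"
      using finH by (auto simp: r_coset_def)
    have "s = s'" if ss: "s \<in> S" "s' \<in> S" and x: "x \<in> H #> s" "x \<in> H #> s'" for s s' x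
    proof -
      obtain h h' where h: "h \<in> H" "h' \<in> H" "x = h \<otimes> s" "x = h' \<otimes> s'"
        using x by (auto simp: r_coset_def)
      have "s \<otimes> inv s' = inv h \<otimes> h'"
        using h SG[OF ss(1)] SG[OF ss(2)]
        by (metis H.mem_carrier inv_closed inv_solve_left inv_solve_right m_assoc m_closed)
      then show ?thesis using uniq ss h by (auto simp: S_def)
    qed
    then show "\<forall>s\<in>S. \<forall>s'\<in>S. s \<noteq> s' \<longrightarrow> (H #> s) \<inter> (H #> s') = {}" by blast
  qed
  then have "card S * card H = card (\<Union>s\<in>S. H #> s)" using card_r by simp
  also have "\<dots> < card D"
  proof (rule psubset_card_mono[OF finD psubsetI])
    show "(\<Union>s\<in>S. H #> s) \<subseteq> D"
    proof
      fix x assume "x \<in> (\<Union>s\<in>S. H #> s)"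
      then obtain h' h k where "h' \<in> H" "h \<in> H" "k \<in> H" "x = h' \<otimes> (h \<otimes> a \<otimes> k)"
        by (auto simp: r_coset_def S_def D_def)
      moreover from this have "x = (h' \<otimes> h) \<otimes> a \<otimes> k" using a by (simp add: m_assoc)
      ultimately show "x \<in> D" unfolding D_def by blast
    qed
    \<comment> \<open>The point \<open>a\<close> of \<open>D\<close> lies outside the union, which
      makes the inequality strict.\<close>
    have "\<exists>h k. a = h \<otimes> a \<otimes> k \<and> h \<in> H \<and> k \<in> H"
      by (intro exI[of _ \<one>]) (use a in auto)
    then have "a \<in> D" by (simp add: D_def)
    moreover have "a \<notin> (\<Union>s\<in>S. H #> s)"
    proof
      assume "a \<in> (\<Union>s\<in>S. H #> s)"
      then obtain s h where s: "s \<in> S" "h \<in> H" "a = h \<otimes> s" by (auto simp: r_coset_def)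
      then have "s \<otimes> inv a = inv h"
        using SG[OF s(1)] by (simp add: inv_mult_group flip: m_assoc)
      moreover have "inv h \<in> H" using s by blast
      ultimately show False using miss[of s] s by (simp add: S_def)
    qed
    ultimately show "(\<Union>s\<in>S. H #> s) \<noteq> D" by auto
  qed
  finally have lt: "card S * card H < card D" .
  \<comment> \<open>For the left cosets an upper bound on the size of the union suffices.\<close>
  have "card (\<Union>s\<in>S. s <# H) \<le> (\<Sum>s\<in>S. card (s <# H))"
    by (rule card_UN_le[OF finS])
  also have "\<dots> \<le> (\<Sum>s\<in>S. card H)"
  proof (rule sum_mono)
    fix s
    have "s <# H = (\<lambda>h. s \<otimes> h) ` H" by (auto simp: l_coset_def)
    then show "card (s <# H) \<le> card H" using card_image_le[OF finH] by simp
  qed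
  finally have "card (\<Union>s\<in>S. s <# H) < card D" using lt by simp
  moreover have "finite (\<Union>s\<in>S. s <# H)"
    using finS finH by (auto simp: l_coset_def)
  ultimately have "\<not> D \<subseteq> (\<Union>s\<in>S. s <# H)"
    using card_mono linorder_not_less by blast
  then obtain b where b: "b \<in> D" "b \<notin> (\<Union>s\<in>S. s <# H)" by blast
  then obtain h k where hk: "h \<in> H" "k \<in> H" "b = h \<otimes> a \<otimes> k" by (auto simp: D_def)
  \<comment> \<open>Dropping \<open>k\<close> from \<open>b\<close> moves into \<open>H #> a\<close>
    without leaving the left coset of \<open>b\<close>. An element of \<open>T\<close> in that left
    coset would lie in \<open>D\<close>, hence in \<open>S\<close>, and would cover
    \<open>b\<close>.\<close>
  have "inv s \<otimes> (h \<otimes> a) \<notin> H" if s: "s \<in> T" for s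
  proof
    assume A: "inv s \<otimes> (h \<otimes> a) \<in> H"
    define l where "l = inv s \<otimes> (h \<otimes> a)"
    have l: "l \<in> H" and sG: "s \<in> carrier G" using A s TG by (auto simp: l_def)
    have sl: "s \<otimes> l = h \<otimes> a"
      using sG hk a by (simp add: l_def flip: m_assoc)
    then have "s = h \<otimes> a \<otimes> inv l"
      using sG l by (metis H.mem_carrier inv_mult_cancel_right(2))
    then have "s \<in> S" using s hk l by (auto simp: S_def D_def)
    moreover have "b = s \<otimes> (l \<otimes> k)"
      using sl hk sG l by (metis H.mem_carrier m_assoc)
    then have "b \<in> s <# H" using l hk by (auto simp: l_coset_def)
    ultimately show False using b by blast
  qed
  then show ?thesis
    using that[of "h \<otimes> a"] hk a by (simp add: inv_mult_cancel_right)
qed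

text \<open>A maximal partial transversal exists, as there are finitely many and
  \<open>{\<one>}\<close> is one. It is full because a missed coset always contains an element that
  can be added together with its inverse.\<close>

lemma full_transversal_exists:
  assumes fin: "finite (carrier G)" and no4: "\<And>x. x \<in> carrier G \<Longrightarrow> ord x \<noteq> 4"
    and H: "subgroup H G"
  shows "\<exists>T. full_transversal G H T"
proof -
  interpret H: subgroup H G by fact
  have "finite {T. partial_transversal G H T}"
    by (rule finite_subset[of _ "Pow (carrier G)"]) (use fin in \<open>auto simp: partial_transversal_def\<close>)
  moreover have "{\<one>} \<in> {T. partial_transversal G H T}" by (simp add: partial_transversal_def)
  ultimately obtain T where T: "partial_transversal G H T"
    and max: "\<And>T'. partial_transversal G H T' \<Longrightarrow> T \<subseteq> T' \<Longrightarrow> T' = T"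
    using finite_has_maximal[of "{T. partial_transversal G H T}"] by auto
  have TG: "\<And>s. s \<in> T \<Longrightarrow> s \<in> carrier G" and Tinv: "\<And>s. s \<in> T \<Longrightarrow> inv s \<in> T"
    using T by (auto simp: partial_transversal_def)
  have "\<exists>s\<in>T. s \<otimes> inv a \<in> H" if a: "a \<in> carrier G" for a
  proof (rule ccontr)
    assume "\<not> ?thesis"
    then have miss: "\<And>s. s \<in> T \<Longrightarrow> s \<otimes> inv a \<notin> H" by blast
    obtain t where t: "t \<in> carrier G" "t \<otimes> inv a \<in> H"
      and miss_l: "\<And>s. s \<in> T \<Longrightarrow> inv s \<otimes> t \<notin> H"
      using missed_coset_representative[OF fin H T a] miss by metis
    have miss_r: "s \<otimes> inv y \<notin> H" if y: "y \<in> carrier G" "y \<otimes> inv a \<in> H" and s: "s \<in> T" for y s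
    proof
      assume "s \<otimes> inv y \<in> H"
      then have "s \<otimes> inv y \<otimes> (y \<otimes> inv a) \<in> H" using y by blast
      moreover have "s \<otimes> inv y \<otimes> (y \<otimes> inv a) = s \<otimes> inv a"
        using y a TG[OF s] by (simp add: inv_mult_cancel_right flip: m_assoc)
      ultimately show False using miss s by simp
    qed
    obtain y where y: "y \<in> carrier G" "y \<otimes> inv a \<in> H" "inv y = y \<or> y \<otimes> y \<notin> H"
      and miss_ly: "\<And>s. s \<in> T \<Longrightarrow> inv s \<otimes> y \<notin> H"
    proof (cases "t \<otimes> t \<in> H")
      case True
      then obtain y where y: "y \<in> carrier G" "y \<otimes> inv t \<in> H" "inv y = y"
        using involution_in_coset[OF fin no4 H t(1)] by blast
      have "y \<otimes> inv t \<otimes> (t \<otimes> inv a) \<in> H" using y t by blast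
      moreover have "y \<otimes> inv t \<otimes> (t \<otimes> inv a) = y \<otimes> inv a"
        using y a t by (simp add: inv_mult_cancel_right flip: m_assoc)
      ultimately have ya: "y \<otimes> inv a \<in> H" by simp
      \<comment> \<open>Replacing \<open>t\<close> by \<open>y\<close> may change the left coset,
        but \<open>y\<close> is its own inverse, so missing its right coset already gives
        this.\<close>
      have "inv s \<otimes> y \<notin> H" if "s \<in> T" for s
        using miss_r[OF y(1) ya Tinv[OF that]] y(3) by simp
      with that y ya show ?thesis by blast
    next
      case False
      with that t miss_l show ?thesis by blast
    qed
    have "partial_transversal G H (insert y (insert (inv y) T))"
      by (rule partial_transversal_insert[OF H T y(1) miss_r[OF y(1,2)] miss_ly y(3)])
    \<comment> \<open>Maximality puts \<open>y\<close> into \<open>T\<close>, although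
      \<open>T\<close> misses the coset \<open>H #> a\<close> containing \<open>y\<close>.\<close>
    then have "insert y (insert (inv y) T) = T" using max by blast
    then show False using miss y by blast
  qed
  then show ?thesis using T by (auto simp: full_transversal_def)
qed

section \<open>Groups with an element of order 4\<close>

text \<open>For the subgroup \<open>{\<one>, z}\<close> with \<open>z = x \<otimes> x\<close>, the
  coset of \<open>x\<close> consists of \<open>x\<close> and its inverse. Either choice of
  representative forces the other into the transversal.\<close>

lemma order_4_not_code_perfect:
  assumes x: "x \<in> carrier G" "ord x = 4"
  shows "\<not> code_perfect G"
proof
  assume cp: "code_perfect G"
  define z where "z = x \<otimes> x"
  have zG: "z \<in> carrier G" using x by (simp add: z_def)
  have "x [^] (4::nat) = \<one>" using x pow_ord_eq_1 by metis
  then have zz: "z \<otimes> z = \<one>" using x by (simp add: z_def numeral_eq_Suc m_assoc)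
  have "\<not> ord x dvd 2" using x by auto
  then have "x [^] (2::nat) \<noteq> \<one>" using x pow_eq_id by blast
  then have z1: "z \<noteq> \<one>" using x by (simp add: z_def numeral_2_eq_2)
  have zinv: "inv z = z" using zz zG by (simp add: inv_equality)
  have H: "subgroup {\<one>, z} G" by (rule subgroupI) (use zG zz zinv in auto)
  \<comment> \<open>Quantifying over all subgroups makes it unnecessary to check that
    \<open>{\<one>, z}\<close> is proper.\<close>
  then obtain T where T: "full_transversal G {\<one>, z} T"
    using cp perfect_code_imp_transversal by (auto simp: code_perfect_iff_all_subgroups)
  then obtain t where t: "t \<in> T" "t \<otimes> inv x \<in> {\<one>, z}"
    using x by (auto simp: full_transversal_def)
  have tG: "t \<in> carrier G" and Tt: "inv t \<in> T"
    using T t by (auto simp: full_transversal_def partial_transversal_def)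
  have "t \<otimes> inv x \<otimes> x = t" using tG x by (simp add: inv_mult_cancel_right)
  then have "t = x \<or> t = z \<otimes> x" using t(2) x by auto
  then have tt: "t \<otimes> t = z"
  proof
    assume "t = z \<otimes> x"
    then have "t \<otimes> t = z \<otimes> z \<otimes> z" using x by (simp add: z_def m_assoc)
    then show ?thesis using zz zG by simp
  qed (simp add: z_def)
  \<comment> \<open>The square \<open>t \<otimes> t\<close> is rewritten to show that
    \<open>t\<close> and \<open>inv t\<close> share a right coset.\<close>
  then have "t \<otimes> inv (inv t) \<in> {\<one>, z}" using tG by simp
  then have "t = inv t"
    using T t Tt unfolding full_transversal_def partial_transversal_def by blast
  then have "t \<otimes> t = \<one>" using tG by (metis r_inv)
  then show False using tt z1 by simp
qed

end

theorem theorem1p1: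
  fixes G :: "('a, 'm) monoid_scheme"
  assumes "group G" and "finite (carrier G)"
  shows "code_perfect G \<longleftrightarrow> \<not> (\<exists>x \<in> carrier G. group.ord G x = 4)"
proof -
  interpret group G by fact
  show ?thesis
    using order_4_not_code_perfect full_transversal_exists[OF assms(2)]
      transversal_imp_perfect_code
    unfolding code_perfect_def by blast
qed

end
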